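(* Let $U_1,U_2$ be two complete ultrametric spaces. Then $U_1$ and $U_2$ are all scale uniform equivalent if and only if there is a common zig-zag $D$-chain of their associated $D$-chains.
   Context: Metric spaces are nonempty. An ultrametric space is a metric space $(X,d)$ with $d(x,y)\le\max\{d(x,z),d(z,y)\}$ for all $x,y,z$. All scale uniform: a map $f\colon X\to Y$ of metric spaces is all scale uniform if there is a non-decreasing function $\varrho\colon[0,\infty)\to[0,\infty)$ with $\varrho(0)=0$, $\lim_{t\to0}\varrho(t)=0$ and $\operatorname{diam}(f(A))\le\varrho(\operatorname{diam}(A))$ for every bounded $A\subset X$. $X$ and $Y$ are all scale uniform equivalent if there is a bijection $f\colon X\to Y$ with $f$ and $f^{-1}$ all scale uniform. $D$-chain: a family of sets $X_k$ ($k\in\mathbb Z$) and surjective maps $\Phi_k\colon X_k\to X_{k+1}$ whose direct limit is trivial (a single point); in particular, for all $x_i\in X_i$, $x_j\in X_j$ there is $k>i,j$ such that $x_i$ and $x_j$ have the same image in $X_k$. Subchain: for a (strictly) increasing $\alpha\colon\mathbb Z\to\mathbb Z$, the $\alpha$-subchain of $(X_k,\Phi_k)$ is $(X_{\alpha(k)},\tilde\Phi_k)$ with $\tilde\Phi_k=\Phi_{\alpha(k+1)-1}\circ\cdots\circ\Phi_{\alpha(k)}\colon X_{\alpha(k)}\to X_{\alpha(k+1)}$. Common zig-zag $D$-chain: a $D$-chain $(Z_k,\mathcal V_k)$ is a common zig-zag $D$-chain of $D$-chains $(X_k,\Phi_k)$ and $(Y_k,\Psi_k)$ if there are increasing maps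 $\alpha,\beta\colon\mathbb Z\to\mathbb Z$ such that $Z_{2k-1}=X_{\alpha(k)}$, $Z_{2k}=Y_{\beta(k)}$ for all $k$ (so $\mathcal V_{2k-1}\colon X_{\alpha(k)}\to Y_{\beta(k)}$ and $\mathcal V_{2k}\colon Y_{\beta(k)}\to X_{\alpha(k+1)}$), and $\mathcal V_{2k}\circ\mathcal V_{2k-1}=\tilde\Phi_k$, $\mathcal V_{2k+1}\circ\mathcal V_{2k}=\tilde\Psi_k$ for all $k$, where $(X_{\alpha(k)},\tilde\Phi_k)$ and $(Y_{\beta(k)},\tilde\Psi_k)$ are the corresponding subchains. Associated $D$-chain of an ultrametric space $U$: $X_k$ is the partition of $U$ into closed balls of radius $2^k$, and $\Phi_k\colon X_k\to X_{k+1}$ sends a ball to the ball of radius $2^{k+1}$ containing it. *)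

theory Defs
  imports "HOL-Analysis.Analysis"
begin

class ultrametric_space = metric_space +
  assumes ultrametric: "dist x y \<le> max (dist x z) (dist z y)"

text \<open>On an unbounded set the real-valued \<open>diameter\<close> is an unspecified number, so the finiteness of
  the diameter of \<open>f ` A\<close>, implicit in the bound by a real number, is required separately.\<close>

definition all_scale_uniform :: "('a::metric_space \<Rightarrow> 'b::metric_space) \<Rightarrow> bool" where
  "all_scale_uniform f \<longleftrightarrow>
     (\<exists>\<rho>::real \<Rightarrow> real.
        \<rho> \<in> {0..} \<rightarrow> {0..} \<and> mono_on {0..} \<rho> \<and> \<rho> 0 = 0 \<and> (\<rho> \<longlongrightarrow> 0) (at_right 0) \<and>
        (\<forall>A. bounded A \<longrightarrow> bounded (f ` A) \<and> diameter (f ` A) \<le> \<rho> (diameter A)))"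

definition all_scale_uniform_equivalent ::
    "'a::metric_space itself \<Rightarrow> 'b::metric_space itself \<Rightarrow> bool" where
  "all_scale_uniform_equivalent _ _ \<longleftrightarrow>
     (\<exists>f :: 'a \<Rightarrow> 'b. bij f \<and> all_scale_uniform f \<and> all_scale_uniform (inv f))"

text \<open>A chain consists of sets \<open>X k\<close> inside one ambient type and functions \<open>\<Phi> k\<close> on that type, of
  which only the restriction to \<open>X k\<close> matters.\<close>

primrec chain_steps :: "(int \<Rightarrow> 'a \<Rightarrow> 'a) \<Rightarrow> int \<Rightarrow> nat \<Rightarrow> 'a \<Rightarrow> 'a" where
  "chain_steps \<Phi> i 0 = id"
| "chain_steps \<Phi> i (Suc n) = \<Phi> (i + int n) \<circ> chain_steps \<Phi> i n"

text \<open>For \<open>i \<le> j\<close> this is the composition of \<open>\<Phi> i, \<dots>, \<Phi> (j - 1)\<close>, mapping \<open>X i\<close> to \<open>X j\<close>; it is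
  not meant to be used for \<open>i > j\<close>.\<close>

definition chain_map :: "(int \<Rightarrow> 'a \<Rightarrow> 'a) \<Rightarrow> int \<Rightarrow> int \<Rightarrow> 'a \<Rightarrow> 'a" where
  "chain_map \<Phi> i j = chain_steps \<Phi> i (nat (j - i))"

definition direct_limit_rel ::
    "(int \<Rightarrow> 'a set) \<Rightarrow> (int \<Rightarrow> 'a \<Rightarrow> 'a) \<Rightarrow> ((int \<times> 'a) \<times> (int \<times> 'a)) set" where
  "direct_limit_rel X \<Phi> =
     {((i, x), (j, y)). x \<in> X i \<and> y \<in> X j \<and>
        (\<exists>k. i \<le> k \<and> j \<le> k \<and> chain_map \<Phi> i k x = chain_map \<Phi> j k y)}"

definition direct_limit ::
    "(int \<Rightarrow> 'a set) \<Rightarrow> (int \<Rightarrow> 'a \<Rightarrow> 'a) \<Rightarrow> (int \<times> 'a) set set" where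
  "direct_limit X \<Phi> = (SIGMA k:UNIV. X k) // direct_limit_rel X \<Phi>"

definition D_chain :: "(int \<Rightarrow> 'a set) \<Rightarrow> (int \<Rightarrow> 'a \<Rightarrow> 'a) \<Rightarrow> bool" where
  "D_chain X \<Phi> \<longleftrightarrow> (\<forall>k. \<Phi> k ` X k = X (k + 1)) \<and> is_singleton (direct_limit X \<Phi>)"

definition subchain_map :: "(int \<Rightarrow> int) \<Rightarrow> (int \<Rightarrow> 'a \<Rightarrow> 'a) \<Rightarrow> int \<Rightarrow> 'a \<Rightarrow> 'a" where
  "subchain_map \<alpha> \<Phi> k = chain_map \<Phi> (\<alpha> k) (\<alpha> (k + 1))"

text \<open>The sets of the two chains may live in different types; in the zig-zag chain they are
  regarded as subsets of the sum type via the injections \<open>Inl\<close> and \<open>Inr\<close>.\<close>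

definition common_zigzag_D_chain ::
    "(int \<Rightarrow> 'a set) \<Rightarrow> (int \<Rightarrow> 'a \<Rightarrow> 'a) \<Rightarrow> (int \<Rightarrow> 'b set) \<Rightarrow> (int \<Rightarrow> 'b \<Rightarrow> 'b) \<Rightarrow>
     (int \<Rightarrow> ('a + 'b) set) \<Rightarrow> (int \<Rightarrow> 'a + 'b \<Rightarrow> 'a + 'b) \<Rightarrow> bool" where
  "common_zigzag_D_chain X \<Phi> Y \<Psi> Z V \<longleftrightarrow>
     D_chain X \<Phi> \<and> D_chain Y \<Psi> \<and> D_chain Z V \<and>
     (\<exists>\<alpha> \<beta> :: int \<Rightarrow> int. strict_mono \<alpha> \<and> strict_mono \<beta> \<and>
        (\<forall>k. Z (2 * k - 1) = Inl ` X (\<alpha> k) \<and> Z (2 * k) = Inr ` Y (\<beta> k) \<and>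
             (\<forall>x \<in> X (\<alpha> k). V (2 * k) (V (2 * k - 1) (Inl x)) = Inl (subchain_map \<alpha> \<Phi> k x)) \<and>
             (\<forall>y \<in> Y (\<beta> k). V (2 * k + 1) (V (2 * k) (Inr y)) = Inr (subchain_map \<beta> \<Psi> k y))))"

definition ball_chain :: "int \<Rightarrow> 'a::ultrametric_space set set" where
  "ball_chain k = range (\<lambda>x. cball x (2 powi k))"

definition ball_chain_map :: "int \<Rightarrow> 'a::ultrametric_space set \<Rightarrow> 'a set" where
  "ball_chain_map k B = (THE C. C \<in> ball_chain (k + 1) \<and> B \<subseteq> C)"

end

theory Submission
  imports Defs
begin

text \<open>
  The theorem says that the large-scale and the small-scale structure of a complete ultrametric
  space are both encoded in its system of dyadic closed balls. Three observations carry the proof.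

  A map is all scale uniform if and only if it respects dyadic scales in two senses: for every
  target scale \<open>2 powi n\<close> some source scale \<open>2 powi m\<close> is mapped within it, and every source scale
  is mapped within some target scale (\<open>all_scale_uniform_imp_dyadic\<close>,
  \<open>dyadic_imp_all_scale_uniform\<close>). Hence only countably many scales matter.

  Let \<open>f\<close> be an equivalence. The two senses together allow to continue a sequence of scales one
  step upwards and one step downwards, which gives scales \<open>\<dots> < c (-1) < c 0 < c 1 < \<dots>\<close> such
  that \<open>f\<close> and its inverse both map points within \<open>2 powi c i\<close> to points within
  \<open>2 powi c (i + 1)\<close> (\<open>ex_common_scales\<close>). Sending a ball of radius \<open>2 powi c i\<close> in one space to
  the ball of radius \<open>2 powi c (i + 1)\<close> around the image of any of its points is therefore well
  defined, and alternating between the spaces gives the zig-zag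
  (\<open>common_zigzag_if_controlled\<close>).

  Conversely, a zig-zag assigns to the balls around a point \<open>x\<close> a nested family of balls in the
  other space with radii tending to \<open>0\<close>. By completeness these balls meet in a single point, the
  image of \<open>x\<close> (\<open>ex_map_inducing_ball_maps\<close>). The maps obtained from the two halves of the zig-zag
  are mutually inverse because the compositions of the ball maps only enlarge a ball around its
  centre, and they are all scale uniform because equal balls have equal images
  (\<open>equivalent_if_interlaced_ball_maps\<close>).
\<close>

section \<open>Dyadic control of a map\<close>

definition dyadic_control :: "('a::metric_space \<Rightarrow> 'b::metric_space) \<Rightarrow> int \<Rightarrow> int \<Rightarrow> bool" where
  "dyadic_control f m n \<longleftrightarrow>
     (\<forall>x y. dist x y \<le> 2 powi m \<longrightarrow> dist (f x) (f y) \<le> 2 powi n)"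

lemma two_powi_mono: "m \<le> n \<Longrightarrow> (2::real) powi m \<le> 2 powi n"
  by (simp add: power_int_increasing)

lemma dyadic_control_mono:
  "dyadic_control f m n \<Longrightarrow> m' \<le> m \<Longrightarrow> n \<le> n' \<Longrightarrow> dyadic_control f m' n'"
  unfolding dyadic_control_def by (meson order_trans two_powi_mono)

lemma ex_two_powi_ge: "\<exists>n::int. t \<le> (2::real) powi n"
proof -
  obtain k :: nat where "t < 2 ^ k"
    using real_arch_pow[of 2 t] by auto
  then have "t \<le> 2 powi int k" by simp
  then show ?thesis ..
qed

lemma ex_two_powi_less:
  assumes "e > 0" shows "\<exists>n::int. (2::real) powi n < e"
proof -
  obtain k :: nat where "(1/2) ^ k < e"
    using real_arch_pow_inv[of e "1/2"] assms by auto
  then have "2 powi (- int k) < e"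
    by (simp add: power_int_minus power_one_over inverse_eq_divide)
  then show ?thesis ..
qed

lemma diameter_le_dist:
  fixes S :: "'a::metric_space set"
  assumes "0 \<le> d" "\<And>x y. x \<in> S \<Longrightarrow> y \<in> S \<Longrightarrow> dist x y \<le> d"
  shows "diameter S \<le> d"
  using assms by (auto simp: diameter_def intro!: cSUP_least)

text \<open>Applied to two-point sets, the diameter condition says
  \<open>dist (f x) (f y) \<le> \<rho> (dist x y)\<close>. Small source scales then come from \<open>\<rho> \<longlongrightarrow> 0\<close> at \<open>0\<close>, large
  target scales from the finiteness of \<open>\<rho>\<close>.\<close>

lemma all_scale_uniform_imp_dyadic:
  fixes f :: "'a::metric_space \<Rightarrow> 'b::metric_space"
  assumes "all_scale_uniform f"
  shows "(\<forall>n. \<exists>m. dyadic_control f m n) \<and> (\<forall>m. \<exists>n. dyadic_control f m n)"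
proof -
  obtain \<rho> :: "real \<Rightarrow> real" where mono: "mono_on {0..} \<rho>" and lim: "(\<rho> \<longlongrightarrow> 0) (at_right 0)"
    and diam: "\<And>A. bounded A \<Longrightarrow> bounded (f ` A) \<and> diameter (f ` A) \<le> \<rho> (diameter A)"
    using assms unfolding all_scale_uniform_def by blast
  have bound: "dist (f x) (f y) \<le> \<rho> t" if "dist x y \<le> t" for x y t
  proof -
    have pair: "bounded (f ` {x, y})" "diameter (f ` {x, y}) \<le> \<rho> (diameter {x, y})"
      using diam[of "{x, y}"] by auto
    have "diameter {x, y} \<le> t"
      by (rule diameter_le_dist) (use that in \<open>auto simp: dist_commute intro: order_trans[OF zero_le_dist]\<close>)
    have "dist (f x) (f y) \<le> diameter (f ` {x, y})"
      by (rule diameter_bounded_bound[OF pair(1)]) auto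
    also have "\<dots> \<le> \<rho> (diameter {x, y})" by (rule pair(2))
    also have "\<dots> \<le> \<rho> t"
      using \<open>diameter {x, y} \<le> t\<close> diameter_ge_0[of "{x, y}"]
      by (intro mono_onD[OF mono]) auto
    finally show ?thesis .
  qed
  have "\<exists>m. dyadic_control f m n" for n
  proof -
    have "eventually (\<lambda>t. \<rho> t < 2 powi n) (at_right 0)"
      using order_tendstoD(2)[OF lim, of "2 powi n"] by simp
    then obtain b where b: "b > 0" "\<And>t. 0 < t \<Longrightarrow> t < b \<Longrightarrow> \<rho> t < 2 powi n"
      unfolding eventually_at_right_field by auto
    obtain m :: int where "2 powi m < b" using ex_two_powi_less[OF b(1)] by blast
    then have "\<rho> (2 powi m) < 2 powi n" using b(2) by simp
    then show ?thesis
      unfolding dyadic_control_def by (meson bound less_imp_le order_trans)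
  qed
  moreover have "\<exists>n. dyadic_control f m n" for m
  proof -
    obtain n :: int where "\<rho> (2 powi m) \<le> 2 powi n" using ex_two_powi_ge by blast
    then show ?thesis
      unfolding dyadic_control_def by (meson bound order_trans)
  qed
  ultimately show ?thesis by blast
qed

text \<open>The witness is the modulus of continuity of \<open>f\<close>. The control of every source scale makes the
  supremum finite, and the control of every target scale makes it tend to \<open>0\<close> at \<open>0\<close>.\<close>

lemma dyadic_imp_all_scale_uniform:
  fixes f :: "'a::metric_space \<Rightarrow> 'b::metric_space"
  assumes small: "\<And>n. \<exists>m. dyadic_control f m n" and large: "\<And>m. \<exists>n. dyadic_control f m n"
  shows "all_scale_uniform f"
proof -
  define D where "D t = {dist (f x) (f y) |x y. dist x y \<le> t}" for t :: real
  define \<rho> where "\<rho> t = Sup (D t)" for t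
  have bdd: "bdd_above (D t)" for t
  proof -
    obtain m :: int where m: "t \<le> 2 powi m" using ex_two_powi_ge by blast
    obtain n where "dyadic_control f m n" using large by blast
    then have "\<And>d. d \<in> D t \<Longrightarrow> d \<le> 2 powi n"
      using m unfolding D_def dyadic_control_def by fastforce
    then show ?thesis by (rule bdd_aboveI)
  qed
  have zero: "0 \<in> D t" if "t \<ge> 0" for t
  proof -
    have "dist undefined (undefined::'a) \<le> t" using that by simp
    then show ?thesis unfolding D_def by (metis (mono_tags, lifting) dist_self mem_Collect_eq)
  qed
  have nonneg: "\<rho> t \<ge> 0" if "t \<ge> 0" for t
    unfolding \<rho>_def by (rule cSup_upper[OF zero[OF that] bdd])
  have upper: "dist (f x) (f y) \<le> \<rho> t" if "dist x y \<le> t" for x y t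
    unfolding \<rho>_def by (rule cSup_upper[OF _ bdd]) (use that in \<open>auto simp: D_def\<close>)
  have mono: "\<rho> s \<le> \<rho> t" if "0 \<le> s" "s \<le> t" for s t
    unfolding \<rho>_def
    by (rule cSup_subset_mono) (use that zero[of s] bdd in \<open>auto simp: D_def intro: order_trans\<close>)
  have rho_le: "\<rho> (2 powi m) \<le> 2 powi n" if "dyadic_control f m n" for m n
    unfolding \<rho>_def
    by (rule cSup_least) (use zero[of "2 powi m"] that in \<open>auto simp: D_def dyadic_control_def\<close>)
  have "D 0 = {0}" using zero[of 0] by (auto simp: D_def)
  then have rho0: "\<rho> 0 = 0" by (simp add: \<rho>_def)
  have lim: "(\<rho> \<longlongrightarrow> 0) (at_right 0)"
  proof (rule tendstoI)
    fix e :: real assume "e > 0"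
    then obtain n :: int where n: "2 powi n < e" using ex_two_powi_less by blast
    obtain m where m: "dyadic_control f m n" using small by blast
    have "dist (\<rho> t) 0 < e" if "0 < t" "t < 2 powi m" for t
    proof -
      have "\<rho> t \<le> \<rho> (2 powi m)" by (rule mono) (use that in auto)
      with rho_le[OF m] n nonneg[of t] that show ?thesis by (simp add: dist_real_def)
    qed
    then show "eventually (\<lambda>t. dist (\<rho> t) 0 < e) (at_right 0)"
      unfolding eventually_at_right_field by (intro exI[of _ "2 powi m"]) auto
  qed
  have diam: "bounded (f ` A) \<and> diameter (f ` A) \<le> \<rho> (diameter A)" if "bounded A" for A
  proof -
    have le: "dist (f x) (f y) \<le> \<rho> (diameter A)" if "x \<in> A" "y \<in> A" for x y
      by (rule upper) (rule diameter_bounded_bound[OF \<open>bounded A\<close> that])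
    have "bounded (f ` A)"
      unfolding bounded_two_points using le by (intro exI[of _ "\<rho> (diameter A)"]) auto
    moreover have "diameter (f ` A) \<le> \<rho> (diameter A)"
      by (rule diameter_le_dist) (use le nonneg[OF diameter_ge_0[OF \<open>bounded A\<close>]] in auto)
    ultimately show ?thesis ..
  qed
  show ?thesis
    unfolding all_scale_uniform_def
    by (rule exI[of _ \<rho>])
      (use rho0 lim diam nonneg mono in \<open>auto simp: mono_on_def\<close>)
qed

section \<open>Closed balls in ultrametric spaces\<close>

text \<open>Every point of an ultrametric ball is a centre of it.\<close>

lemma cball_eq_if_dist_le:
  fixes x y :: "'a::ultrametric_space"
  assumes "dist x y \<le> r"
  shows "cball x r = cball y r"
proof -
  have "cball u r \<subseteq> cball v r" if "dist u v \<le> r" for u v :: 'a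
  proof
    fix z assume "z \<in> cball u r"
    then show "z \<in> cball v r"
      using that ultrametric[of v z u] by (simp add: dist_commute)
  qed
  from this[of x y] this[of y x] assms show ?thesis by (auto simp: dist_commute)
qed

lemma cball_eq_iff:
  fixes x y :: "'a::ultrametric_space"
  assumes "r \<ge> 0"
  shows "cball x r = cball y r \<longleftrightarrow> dist x y \<le> r"
  using assms cball_eq_if_dist_le[of x y r] centre_in_cball[of y r] by (metis mem_cball)

lemma ball_chain_eq_cball:
  assumes "B \<in> ball_chain k" "x \<in> B"
  shows "B = cball x (2 powi k)"
  using assms cball_eq_if_dist_le unfolding ball_chain_def by fastforce

lemma cball_in_ball_chain [simp]: "cball x (2 powi k) \<in> ball_chain k"
  by (simp add: ball_chain_def)

lemma ball_chain_map_cball: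
  "ball_chain_map k (cball x (2 powi k)) = cball x (2 powi (k + 1))"
  unfolding ball_chain_map_def
proof (rule the_equality)
  show "cball x (2 powi (k + 1)) \<in> ball_chain (k + 1) \<and>
        cball x (2 powi k) \<subseteq> cball x (2 powi (k + 1))"
    by (simp add: subset_cball two_powi_mono)
next
  fix C assume C: "C \<in> ball_chain (k + 1) \<and> cball x (2 powi k) \<subseteq> C"
  moreover have "x \<in> cball x (2 powi k)" by simp
  ultimately show "C = cball x (2 powi (k + 1))"
    using ball_chain_eq_cball by blast
qed

section \<open>Chains of quotients of one set\<close>

lemma chain_map_quotients:
  assumes step: "\<And>k x. \<Phi> k (q k x) = q (k + 1) x" and "i \<le> j"
  shows "chain_map \<Phi> i j (q i x) = q j x"
proof -
  have "chain_steps \<Phi> i n (q i x) = q (i + int n) x" for n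
    by (induction n) (simp_all add: step algebra_simps)
  from this[of "nat (j - i)"] \<open>i \<le> j\<close> show ?thesis by (simp add: chain_map_def)
qed

text \<open>Both the ball chains and the zig-zag constructed below consist of successively coarser
  quotients of one set of points. Such a chain has a trivial direct limit as soon as any two
  points are eventually identified.\<close>

lemma D_chain_quotients:
  assumes X: "\<And>k. X k = range (q k)"
    and step: "\<And>k x. \<Phi> k (q k x) = q (k + 1) x"
    and merge: "\<And>x y i. \<exists>k\<ge>i. q k x = q k y"
  shows "D_chain X \<Phi>"
proof -
  let ?S = "SIGMA k:UNIV. X k"
  (* All elements are related, so the direct limit has exactly one class. *)
  have "\<exists>k. i \<le> k \<and> j \<le> k \<and> chain_map \<Phi> i k x = chain_map \<Phi> j k y"
    if xy: "x \<in> X i" "y \<in> X j" for i j x y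
  proof -
    obtain u v where uv: "x = q i u" "y = q j v" using xy X by auto
    obtain k where "k \<ge> max i j" "q k u = q k v" using merge by blast
    then show ?thesis
      unfolding uv by (intro exI[of _ k]) (simp add: chain_map_quotients[of \<Phi> q, OF step])
  qed
  then have "direct_limit_rel X \<Phi> = ?S \<times> ?S"
    unfolding direct_limit_rel_def by auto
  moreover have "?S \<noteq> {}" using X by auto
  ultimately have "direct_limit X \<Phi> = {?S}"
    unfolding direct_limit_def quotient_def by auto
  moreover have "\<Phi> k ` X k = X (k + 1)" for k
    using step by (auto simp: X image_image)
  ultimately show ?thesis unfolding D_chain_def by simp
qed

lemma D_chain_ball_chain: "D_chain (ball_chain :: int \<Rightarrow> 'a::ultrametric_space set set) ball_chain_map"
proof (rule D_chain_quotients[where q = "\<lambda>k x. cball x (2 powi k)"])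
  fix x y :: 'a and i :: int
  obtain n :: int where "dist x y \<le> 2 powi n" using ex_two_powi_ge by blast
  then have "dist x y \<le> 2 powi (max i n)"
    using two_powi_mono[of n "max i n"] by simp
  then show "\<exists>k\<ge>i. cball x (2 powi k) = cball y (2 powi k)"
    by (intro exI[of _ "max i n"]) (simp add: cball_eq_if_dist_le)
qed (simp_all add: ball_chain_def ball_chain_map_cball)

lemma subchain_map_cball:
  assumes "strict_mono \<alpha>"
  shows "subchain_map \<alpha> ball_chain_map k (cball x (2 powi \<alpha> k)) = cball x (2 powi \<alpha> (k + 1))"
  unfolding subchain_map_def
  using assms
  by (intro chain_map_quotients[where q = "\<lambda>k x. cball x (2 powi k)"])
    (simp_all add: ball_chain_map_cball strict_mono_less_eq)

section \<open>Increasing sequences of integer scales\<close>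

lemma strict_mono_int_diff_le:
  fixes c :: "int \<Rightarrow> int"
  assumes "strict_mono c" "i \<le> j"
  shows "j - i \<le> c j - c i"
  using \<open>i \<le> j\<close>
proof (induction rule: int_ge_induct)
  case (step j)
  have "c j < c (j + 1)" using assms(1) by (simp add: strict_mono_less)
  with step.IH show ?case by linarith
qed simp

lemma strict_mono_int_unbounded:
  fixes c :: "int \<Rightarrow> int"
  assumes "strict_mono c"
  shows "\<exists>k. c k \<le> n" "\<exists>k\<ge>i. n \<le> c k"
proof -
  show "\<exists>k. c k \<le> n"
    using strict_mono_int_diff_le[OF assms, of "min 0 (n - c 0)" 0]
    by (intro exI[of _ "min 0 (n - c 0)"]) linarith
  show "\<exists>k\<ge>i. n \<le> c k"
    using strict_mono_int_diff_le[OF assms, of i "max i (n - c i + i)"]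
    by (intro exI[of _ "max i (n - c i + i)"]) linarith
qed

text \<open>Dependent choice in both directions from an arbitrary starting point.\<close>

lemma ex_bi_infinite_sequence:
  fixes R :: "'s \<Rightarrow> 's \<Rightarrow> bool"
  assumes "\<And>m. \<exists>n. R m n" and "\<And>n. \<exists>m. R m n"
  shows "\<exists>c :: int \<Rightarrow> 's. \<forall>i. R (c i) (c (i + 1))"
proof -
  obtain up down where up: "\<And>m. R m (up m)" and down: "\<And>n. R (down n) n"
    using assms by metis
  define c where "c i = (if 0 \<le> i then (up ^^ nat i) undefined else (down ^^ nat (- i)) undefined)"
    for i :: int
  have "R (c i) (c (i + 1))" for i
  proof (cases "0 \<le> i")
    case True
    then have "nat (i + 1) = Suc (nat i)" by simp
    then show ?thesis using True up by (simp add: c_def)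
  next
    case False
    then have "nat (- i) = Suc (nat (- (i + 1)))" by simp
    moreover have "c (i + 1) = (down ^^ nat (- (i + 1))) undefined"
      using False by (cases "i = - 1") (auto simp: c_def)
    ultimately show ?thesis using False down by (simp add: c_def)
  qed
  then show ?thesis by blast
qed

lemma strict_mono_int_Suc:
  fixes c :: "int \<Rightarrow> int"
  assumes "\<And>i. c i < c (i + 1)"
  shows "strict_mono c"
proof (rule strict_monoI)
  fix i j :: int assume "i < j"
  then show "c i < c j"
  proof (induction rule: int_gr_induct)
    case base show ?case by (rule assms)
  next
    case (step j) then show ?case using assms[of j] by linarith
  qed
qed

text \<open>A target scale can always be enlarged and a source scale always be reduced, so one sequence of
  scales serves both maps and can be made strictly increasing.\<close>

lemma ex_common_scales:
  assumes f: "all_scale_uniform f" and g: "all_scale_uniform g"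
  shows "\<exists>c :: int \<Rightarrow> int. strict_mono c \<and>
    (\<forall>i. dyadic_control f (c i) (c (i + 1)) \<and> dyadic_control g (c i) (c (i + 1)))"
proof -
  define R where "R m n \<longleftrightarrow> m < n \<and> dyadic_control f m n \<and> dyadic_control g m n"
    for m n :: int
  note fd = all_scale_uniform_imp_dyadic[OF f] and gd = all_scale_uniform_imp_dyadic[OF g]
  have "\<exists>n. R m n" for m
  proof -
    obtain n1 n2 where "dyadic_control f m n1" "dyadic_control g m n2" using fd gd by blast
    then have "R m (max (m + 1) (max n1 n2))"
      unfolding R_def by (auto intro: dyadic_control_mono)
    then show ?thesis ..
  qed
  moreover have "\<exists>m. R m n" for n
  proof -
    obtain m1 m2 where "dyadic_control f m1 n" "dyadic_control g m2 n" using fd gd by blast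
    then have "R (min (n - 1) (min m1 m2)) n"
      unfolding R_def by (auto intro: dyadic_control_mono)
    then show ?thesis ..
  qed
  ultimately have "\<exists>c :: int \<Rightarrow> int. \<forall>i. R (c i) (c (i + 1))"
    by (rule ex_bi_infinite_sequence)
  then obtain c :: "int \<Rightarrow> int" where "\<And>i. R (c i) (c (i + 1))" by blast
  then have "c i < c (i + 1)" "dyadic_control f (c i) (c (i + 1))"
      "dyadic_control g (c i) (c (i + 1))" for i
    unfolding R_def by blast+
  then show ?thesis by (blast intro: strict_mono_int_Suc)
qed

section \<open>From an equivalence to a zig-zag\<close>

text \<open>All sets of the zig-zag are viewed as quotients of the first space: its point \<open>x\<close> is sent to the
  ball around \<open>x\<close> at odd positions and to the ball around \<open>f x\<close> at even ones. The control of \<open>f\<close>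
  and \<open>g\<close> says exactly that each quotient map factors through the previous one.\<close>

lemma common_zigzag_if_controlled:
  fixes f :: "'a::ultrametric_space \<Rightarrow> 'b::ultrametric_space" and g :: "'b \<Rightarrow> 'a"
    and c :: "int \<Rightarrow> int"
  assumes gf: "\<And>x. g (f x) = x" and fg: "\<And>y. f (g y) = y"
    and c: "strict_mono c"
    and fc: "\<And>i. dyadic_control f (c i) (c (i + 1))"
    and gc: "\<And>i. dyadic_control g (c i) (c (i + 1))"
  shows "\<exists>Z V. common_zigzag_D_chain (ball_chain :: int \<Rightarrow> 'a set set) ball_chain_map
           (ball_chain :: int \<Rightarrow> 'b set set) ball_chain_map Z V"
proof -
  define q where "q i x = (if odd i then Inl (cball x (2 powi c i))
                           else Inr (cball (f x) (2 powi c i)))" for i x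
  define Z where "Z i = range (q i)" for i
  define V where "V i z = (case z of
       Inl B \<Rightarrow> Inr (cball (f (SOME x. x \<in> B)) (2 powi c (i + 1)))
     | Inr C \<Rightarrow> Inl (cball (g (SOME y. y \<in> C)) (2 powi c (i + 1))))" for i z
  have some_in: "dist x (SOME u. u \<in> cball x (2 powi n)) \<le> 2 powi n"
    for x :: "'x::metric_space" and n
    using someI[of "\<lambda>u. u \<in> cball x (2 powi n)" x] by simp
  have step: "V i (q i x) = q (i + 1) x" for i x
  proof (cases "odd i")
    case True
    have "dist (f x) (f (SOME u. u \<in> cball x (2 powi c i))) \<le> 2 powi c (i + 1)"
      using fc some_in unfolding dyadic_control_def by blast
    from cball_eq_if_dist_le[OF this] show ?thesis using True by (simp add: q_def V_def)
  next
    case False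
    have "dist (g (f x)) (g (SOME u. u \<in> cball (f x) (2 powi c i))) \<le> 2 powi c (i + 1)"
      using gc some_in unfolding dyadic_control_def by blast
    from cball_eq_if_dist_le[OF this] show ?thesis using False by (simp add: q_def V_def gf)
  qed
  have DZ: "D_chain Z V"
  proof (rule D_chain_quotients[where q = q, OF Z_def step])
    fix x y :: 'a and i :: int
    obtain n :: int where n: "dist x y \<le> 2 powi n" using ex_two_powi_ge by blast
    obtain n' :: int where n': "dist (f x) (f y) \<le> 2 powi n'" using ex_two_powi_ge by blast
    obtain k where k: "k \<ge> i" "max n n' \<le> c k"
      using strict_mono_int_unbounded(2)[OF c] by blast
    have "dist x y \<le> 2 powi c k" "dist (f x) (f y) \<le> 2 powi c k"
      using n n' k(2) two_powi_mono[of n "c k"] two_powi_mono[of n' "c k"] by auto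
    then have "q k x = q k y" by (simp add: q_def cball_eq_if_dist_le)
    with k(1) show "\<exists>k\<ge>i. q k x = q k y" by blast
  qed
  define \<alpha> where "\<alpha> k = c (2 * k - 1)" for k
  define \<beta> where "\<beta> k = c (2 * k)" for k
  have mono: "strict_mono \<alpha>" "strict_mono \<beta>"
    using c by (simp_all add: \<alpha>_def \<beta>_def strict_mono_def)
  have "range f = UNIV" by (metis fg surjI)
  then have rf: "range (\<lambda>x. h (f x)) = range h" for h :: "'b \<Rightarrow> 'a set + 'b set"
    by (metis image_image)
  have sets: "Z (2 * k - 1) = Inl ` ball_chain (\<alpha> k)" "Z (2 * k) = Inr ` ball_chain (\<beta> k)" for k
    using rf[of "\<lambda>y. Inr (cball y (2 powi c (2 * k)))"]
    by (auto simp: Z_def q_def ball_chain_def \<alpha>_def \<beta>_def image_image)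
  have compX: "V (2 * k) (V (2 * k - 1) (Inl B)) = Inl (subchain_map \<alpha> ball_chain_map k B)"
    if "B \<in> ball_chain (\<alpha> k)" for k B
  proof -
    obtain x where B: "B = cball x (2 powi \<alpha> k)" using \<open>B \<in> _\<close> by (auto simp: ball_chain_def)
    have "Inl B = q (2 * k - 1) x" by (simp add: B q_def \<alpha>_def)
    then have "V (2 * k) (V (2 * k - 1) (Inl B)) = q (2 * k + 1) x"
      using step[of "2 * k - 1" x] step[of "2 * k" x] by simp
    also have "\<dots> = Inl (cball x (2 powi \<alpha> (k + 1)))" by (simp add: q_def \<alpha>_def algebra_simps)
    finally show ?thesis by (simp add: B subchain_map_cball[OF mono(1)])
  qed
  have compY: "V (2 * k + 1) (V (2 * k) (Inr C)) = Inr (subchain_map \<beta> ball_chain_map k C)"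
    if "C \<in> ball_chain (\<beta> k)" for k C
  proof -
    obtain y where C: "C = cball y (2 powi \<beta> k)" using \<open>C \<in> _\<close> by (auto simp: ball_chain_def)
    have "Inr C = q (2 * k) (g y)" by (simp add: C q_def \<beta>_def fg)
    then have "V (2 * k + 1) (V (2 * k) (Inr C)) = q (2 * k + 1 + 1) (g y)"
      by (simp add: step)
    also have "\<dots> = Inr (cball y (2 powi \<beta> (k + 1)))" by (simp add: q_def \<beta>_def fg algebra_simps)
    finally show ?thesis by (simp add: C subchain_map_cball[OF mono(2)])
  qed
  have "common_zigzag_D_chain (ball_chain :: int \<Rightarrow> 'a set set) ball_chain_map
           (ball_chain :: int \<Rightarrow> 'b set set) ball_chain_map Z V"
    unfolding common_zigzag_D_chain_def
    by (intro conjI exI[of _ \<alpha>] exI[of _ \<beta>] allI ballI)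
      (fact D_chain_ball_chain DZ mono sets | rule compX compY, assumption)+
  then show ?thesis by blast
qed

section \<open>From a zig-zag to an equivalence\<close>

text \<open>The radii tend to \<open>0\<close> as the index tends to \<open>-\<infinity>\<close>, so this is Cantor's intersection theorem
  for the balls of nonpositive index. The balls of positive index contain these.\<close>

lemma ex_point_in_nested_balls:
  fixes C :: "int \<Rightarrow> 'b::{ultrametric_space, complete_space} set"
  assumes \<beta>: "strict_mono \<beta>" and ball: "\<And>k. C k \<in> ball_chain (\<beta> k)"
    and nested: "\<And>k. C k \<subseteq> C (k + 1)"
  shows "\<exists>y. \<forall>k. y \<in> C k"
proof -
  have C_mono: "C i \<subseteq> C j" if "i \<le> j" for i j
    using that by (induction rule: int_ge_induct) (use nested in blast)+
  have below: "C (- int (nat (- k))) \<subseteq> C k" for k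
    by (rule C_mono) linarith
  have dist: "dist x y \<le> 2 powi \<beta> k" if "x \<in> C k" "y \<in> C k" for x y k
    using ball_chain_eq_cball[OF ball that(1)] that(2) by simp
  obtain y where y: "\<And>n. y \<in> C (- int n)"
  proof (rule decreasing_closed_nest[of "\<lambda>n. C (- int n)"])
    show "closed (C (- int n))" for n
      using ball[of "- int n"] by (auto simp: ball_chain_def)
    show "C (- int n) \<noteq> {}" for n
    proof -
      obtain x where "C (- int n) = cball x (2 powi \<beta> (- int n))"
        using ball[of "- int n"] by (auto simp: ball_chain_def)
      then have "x \<in> C (- int n)" by simp
      then show ?thesis by blast
    qed
    show "m \<le> n \<Longrightarrow> C (- int n) \<subseteq> C (- int m)" for m n
      by (rule C_mono) simp
    fix e :: real assume "e > 0"
    then obtain n :: int where n: "2 powi n < e" using ex_two_powi_less by blast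
    obtain k where k: "\<beta> k \<le> n" using strict_mono_int_unbounded(1)[OF \<beta>] by blast
    have "dist x y < e" if "x \<in> C (- int (nat (- k)))" "y \<in> C (- int (nat (- k)))" for x y
    proof -
      have "x \<in> C k" "y \<in> C k" using that below by blast+
      then show ?thesis using dist[of x k y] two_powi_mono[OF k] n by linarith
    qed
    then show "\<exists>n. \<forall>x\<in>C (- int n). \<forall>y\<in>C (- int n). dist x y < e" by blast
  qed blast
  have "y \<in> C k" for k
    using y below by blast
  then show ?thesis by blast
qed

lemma eq_if_cballs_eq:
  fixes x y :: "'a::ultrametric_space" and \<alpha> :: "int \<Rightarrow> int"
  assumes \<alpha>: "strict_mono \<alpha>" and eq: "\<And>k. cball x (2 powi \<alpha> k) = cball y (2 powi \<alpha> k)"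
  shows "x = y"
proof (rule ccontr)
  assume "x \<noteq> y"
  then obtain n :: int where n: "2 powi n < dist x y" using ex_two_powi_less[of "dist x y"] by auto
  obtain k where "\<alpha> k \<le> n" using strict_mono_int_unbounded(1)[OF \<alpha>] by blast
  then show False using eq[of k] n two_powi_mono[of "\<alpha> k" n] by (simp add: cball_eq_iff)
qed

text \<open>The map is defined pointwise as an intersection point of the nested images of balls; every
  such image is then the ball around the value.\<close>

lemma ex_map_inducing_ball_maps:
  fixes P :: "int \<Rightarrow> 'a::ultrametric_space set \<Rightarrow> 'b::{ultrametric_space, complete_space} set"
    and \<alpha> \<beta> :: "int \<Rightarrow> int"
  assumes \<beta>: "strict_mono \<beta>"
    and ball: "\<And>k x. P k (cball x (2 powi \<alpha> k)) \<in> ball_chain (\<beta> k)"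
    and nested: "\<And>k x. P k (cball x (2 powi \<alpha> k)) \<subseteq> P (k + 1) (cball x (2 powi \<alpha> (k + 1)))"
  shows "\<exists>f. \<forall>k x. P k (cball x (2 powi \<alpha> k)) = cball (f x) (2 powi \<beta> k)"
proof -
  have "\<exists>y. \<forall>k. y \<in> P k (cball x (2 powi \<alpha> k))" for x
    by (rule ex_point_in_nested_balls[OF \<beta>, of "\<lambda>k. P k (cball x (2 powi \<alpha> k))"])
      (fact ball nested)+
  then obtain f where "\<And>x k. f x \<in> P k (cball x (2 powi \<alpha> k))" by metis
  then show ?thesis using ball_chain_eq_cball[OF ball] by blast
qed

lemma all_scale_uniform_if_ball_maps:
  fixes f :: "'a::ultrametric_space \<Rightarrow> 'b::ultrametric_space" and \<alpha> \<beta> :: "int \<Rightarrow> int"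
  assumes "strict_mono \<alpha>" "strict_mono \<beta>"
    and P: "\<And>k x. P k (cball x (2 powi \<alpha> k)) = cball (f x) (2 powi \<beta> k)"
  shows "all_scale_uniform f"
proof -
  have control: "dyadic_control f (\<alpha> k) (\<beta> k)" for k
    unfolding dyadic_control_def
  proof (intro allI impI)
    fix x y :: 'a assume "dist x y \<le> 2 powi \<alpha> k"
    then have "cball (f x) (2 powi \<beta> k) = cball (f y) (2 powi \<beta> k)"
      using P[of k x] P[of k y] cball_eq_if_dist_le by metis
    then show "dist (f x) (f y) \<le> 2 powi \<beta> k" by (simp add: cball_eq_iff)
  qed
  show ?thesis
  proof (rule dyadic_imp_all_scale_uniform)
    fix n
    obtain k where "\<beta> k \<le> n" using strict_mono_int_unbounded(1)[OF assms(2)] by blast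
    then show "\<exists>m. dyadic_control f m n" using dyadic_control_mono[OF control] by blast
  next
    fix m
    obtain k where "m \<le> \<alpha> k" using strict_mono_int_unbounded(2)[OF assms(1)] by blast
    then show "\<exists>n. dyadic_control f m n" using dyadic_control_mono[OF control] by blast
  qed
qed

text \<open>The zig-zag in symmetric form, with \<open>P\<close> and \<open>Q\<close> for its maps from the first space to the
  second and back. Exchanging the two spaces replaces \<open>(\<alpha>, \<beta>, P, Q)\<close> by \<open>(\<beta>, \<alpha>', Q, P')\<close>, where
  the prime denotes a shift of the index by one; the previous two lemmas thus apply to both
  halves.\<close>

lemma equivalent_if_interlaced_ball_maps:
  fixes P :: "int \<Rightarrow> 'a::{ultrametric_space, complete_space} set \<Rightarrow>
                'b::{ultrametric_space, complete_space} set"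
    and Q :: "int \<Rightarrow> 'b set \<Rightarrow> 'a set" and \<alpha> \<beta> :: "int \<Rightarrow> int"
  assumes \<alpha>: "strict_mono \<alpha>" and \<beta>: "strict_mono \<beta>"
    and P: "\<And>k B. B \<in> ball_chain (\<alpha> k) \<Longrightarrow> P k B \<in> ball_chain (\<beta> k)"
    and Q: "\<And>k C. C \<in> ball_chain (\<beta> k) \<Longrightarrow> Q k C \<in> ball_chain (\<alpha> (k + 1))"
    and QP: "\<And>k x. Q k (P k (cball x (2 powi \<alpha> k))) = cball x (2 powi \<alpha> (k + 1))"
    and PQ: "\<And>k y. P (k + 1) (Q k (cball y (2 powi \<beta> k))) = cball y (2 powi \<beta> (k + 1))"
  shows "all_scale_uniform_equivalent TYPE('a) TYPE('b)"
proof -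
  define \<alpha>' where "\<alpha>' k = \<alpha> (k + 1)" for k
  have \<alpha>': "strict_mono \<alpha>'" using \<alpha> by (simp add: \<alpha>'_def strict_mono_def)
  (* The larger ball around x is obtained by going through Q, so that P, Q, P is applied to the
     smaller one; the last two maps enlarge its image under P without moving the centre. *)
  have "P k (cball x (2 powi \<alpha> k)) \<subseteq> P (k + 1) (cball x (2 powi \<alpha> (k + 1)))" for k x
  proof -
    obtain y where y: "P k (cball x (2 powi \<alpha> k)) = cball y (2 powi \<beta> k)"
      using P[of "cball x (2 powi \<alpha> k)" k] by (auto simp: ball_chain_def)
    then have "P (k + 1) (cball x (2 powi \<alpha> (k + 1))) = cball y (2 powi \<beta> (k + 1))"
      using QP[of k x] PQ[of k y] by simp
    moreover have "\<beta> k \<le> \<beta> (k + 1)" using \<beta> by (simp add: strict_mono_less_eq)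
    ultimately show ?thesis using y by (simp add: subset_cball two_powi_mono)
  qed
  then obtain f where f: "\<And>k x. P k (cball x (2 powi \<alpha> k)) = cball (f x) (2 powi \<beta> k)"
    using ex_map_inducing_ball_maps[where P=P, OF \<beta>, of \<alpha>] P cball_in_ball_chain by blast
  have "Q k (cball y (2 powi \<beta> k)) \<subseteq> Q (k + 1) (cball y (2 powi \<beta> (k + 1)))" for k y
  proof -
    obtain x where x: "Q k (cball y (2 powi \<beta> k)) = cball x (2 powi \<alpha> (k + 1))"
      using Q[of "cball y (2 powi \<beta> k)" k] by (auto simp: ball_chain_def)
    then have "Q (k + 1) (cball y (2 powi \<beta> (k + 1))) = cball x (2 powi \<alpha> (k + 1 + 1))"
      using PQ[of k y] QP[of "k + 1" x] by simp
    moreover have "\<alpha> (k + 1) \<le> \<alpha> (k + 1 + 1)" using \<alpha> by (simp add: strict_mono_less_eq)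
    ultimately show ?thesis using x by (simp add: subset_cball two_powi_mono)
  qed
  then obtain g where g: "\<And>k y. Q k (cball y (2 powi \<beta> k)) = cball (g y) (2 powi \<alpha>' k)"
    using ex_map_inducing_ball_maps[where P=Q, OF \<alpha>', of \<beta>] Q cball_in_ball_chain
    unfolding \<alpha>'_def by blast
  have gf: "g (f x) = x" for x
    by (rule eq_if_cballs_eq[OF \<alpha>']) (metis QP f g \<alpha>'_def)
  have fg: "f (g y) = y" for y
  proof (rule eq_if_cballs_eq[OF \<beta>])
    fix k
    show "cball (f (g y)) (2 powi \<beta> k) = cball y (2 powi \<beta> k)"
      using PQ[of "k - 1" y] f[of k "g y"] g[of "k - 1" y] by (simp add: \<alpha>'_def)
  qed
  have "bij f" using gf fg by (intro o_bij[of g]) (auto simp: fun_eq_iff)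
  moreover have "inv f = g" using gf fg by (metis inv_equality)
  moreover have "all_scale_uniform f" by (rule all_scale_uniform_if_ball_maps[where P = P, OF \<alpha> \<beta> f])
  moreover have "all_scale_uniform g" by (rule all_scale_uniform_if_ball_maps[where P = Q, OF \<beta> \<alpha>' g])
  ultimately show ?thesis unfolding all_scale_uniform_equivalent_def by auto
qed

lemma equivalent_if_common_zigzag:
  assumes "common_zigzag_D_chain
     (ball_chain :: int \<Rightarrow> 'a::{ultrametric_space, complete_space} set set) ball_chain_map
     (ball_chain :: int \<Rightarrow> 'b::{ultrametric_space, complete_space} set set) ball_chain_map Z V"
  shows "all_scale_uniform_equivalent TYPE('a) TYPE('b)"
proof -
  obtain \<alpha> \<beta> where DZ: "D_chain Z V" and \<alpha>: "strict_mono \<alpha>" and \<beta>: "strict_mono \<beta>"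
    and ZX: "\<And>k. Z (2 * k - 1) = Inl ` ball_chain (\<alpha> k)"
    and ZY: "\<And>k. Z (2 * k) = Inr ` ball_chain (\<beta> k)"
    and X: "\<And>k B. B \<in> ball_chain (\<alpha> k) \<Longrightarrow>
              V (2 * k) (V (2 * k - 1) (Inl B)) = Inl (subchain_map \<alpha> ball_chain_map k B)"
    and Y: "\<And>k C. C \<in> ball_chain (\<beta> k) \<Longrightarrow>
              V (2 * k + 1) (V (2 * k) (Inr C)) = Inr (subchain_map \<beta> ball_chain_map k C)"
    using assms unfolding common_zigzag_D_chain_def by metis
  have V_in: "V i z \<in> Z (i + 1)" if "z \<in> Z i" for i z
    using DZ that unfolding D_chain_def by blast
  define P where "P k B = projr (V (2 * k - 1) (Inl B))" for k B
  define Q where "Q k C = projl (V (2 * k) (Inr C))" for k C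
  have P: "P k B \<in> ball_chain (\<beta> k)" "V (2 * k - 1) (Inl B) = Inr (P k B)"
    if "B \<in> ball_chain (\<alpha> k)" for k B
    using V_in[of "Inl B" "2 * k - 1"] that by (auto simp: ZX ZY P_def)
  have Q: "Q k C \<in> ball_chain (\<alpha> (k + 1))" "V (2 * k) (Inr C) = Inl (Q k C)"
    if "C \<in> ball_chain (\<beta> k)" for k C
  proof -
    have "Z (2 * k + 1) = Inl ` ball_chain (\<alpha> (k + 1))"
      using ZX[of "k + 1"] by (simp add: algebra_simps)
    moreover have "V (2 * k) (Inr C) \<in> Z (2 * k + 1)"
      using V_in[of "Inr C" "2 * k"] that by (simp add: ZY)
    ultimately show "Q k C \<in> ball_chain (\<alpha> (k + 1))" "V (2 * k) (Inr C) = Inl (Q k C)"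
      by (auto simp: Q_def)
  qed
  show ?thesis
  proof (rule equivalent_if_interlaced_ball_maps[OF \<alpha> \<beta>, of P Q])
    show "Q k (P k (cball x (2 powi \<alpha> k))) = cball x (2 powi \<alpha> (k + 1))" for k x
    proof -
      have B: "cball x (2 powi \<alpha> k) \<in> ball_chain (\<alpha> k)" by simp
      show ?thesis using X[OF B] P[OF B] Q(2)[OF P(1)[OF B]] by (simp add: subchain_map_cball[OF \<alpha>])
    qed
    show "P (k + 1) (Q k (cball y (2 powi \<beta> k))) = cball y (2 powi \<beta> (k + 1))" for k y
    proof -
      have C: "cball y (2 powi \<beta> k) \<in> ball_chain (\<beta> k)" by simp
      have "V (2 * k + 1) (Inl (Q k (cball y (2 powi \<beta> k)))) =
              Inr (P (k + 1) (Q k (cball y (2 powi \<beta> k))))"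
        using P(2)[OF Q(1)[OF C]] by (simp add: add.commute)
      then show ?thesis
        using Y[OF C] Q(2)[OF C] by (simp add: subchain_map_cball[OF \<beta>])
    qed
  qed (use P Q in auto)
qed

theorem theorem3p9:
  "all_scale_uniform_equivalent
      TYPE('a::{ultrametric_space, complete_space}) TYPE('b::{ultrametric_space, complete_space})
   \<longleftrightarrow>
   (\<exists>Z V. common_zigzag_D_chain
             (ball_chain :: int \<Rightarrow> 'a set set) ball_chain_map
             (ball_chain :: int \<Rightarrow> 'b set set) ball_chain_map Z V)"
  (is "?L \<longleftrightarrow> ?R")
proof
  assume ?L
  then obtain f :: "'a \<Rightarrow> 'b" where f: "bij f" "all_scale_uniform f" "all_scale_uniform (inv f)"
    unfolding all_scale_uniform_equivalent_def by blast
  obtain c :: "int \<Rightarrow> int" where c: "strict_mono c" "\<And>i. dyadic_control f (c i) (c (i + 1))"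
      "\<And>i. dyadic_control (inv f) (c i) (c (i + 1))"
    using ex_common_scales[OF f(2,3)] by blast
  have "inv f (f x) = x" "f (inv f y) = y" for x y
    using f(1) by (simp_all add: bij_is_inj bij_is_surj surj_f_inv_f)
  then show ?R by (rule common_zigzag_if_controlled[OF _ _ c])
next
  assume ?R
  then show ?L using equivalent_if_common_zigzag by blast
qed

end
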